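(* Let $S_1,S_2$ be sets, let $\mathcal{U}_2\in\beta S_2$ and let $\kappa=|S_1|$. The following are equivalent: (1) for every $\mathcal{U}_1\in\beta S_1$, $\mathcal{U}_1\otimes\mathcal{U}_2=\mathcal{F}(\mathcal{U}_1\times\mathcal{U}_2)$; (2) $\mathcal{U}_2$ is $\kappa^{+}$-complete.
   Context: For $\mathcal{U}_1\in\beta S_1$, $\mathcal{U}_2\in\beta S_2$: $\mathcal{U}_1\otimes\mathcal{U}_2$ is the ultrafilter on $S_1\times S_2$ with $A\in\mathcal{U}_1\otimes\mathcal{U}_2$ iff $\{s_1\in S_1\mid\{s_2\in S_2\mid (s_1,s_2)\in A\}\in\mathcal{U}_2\}\in\mathcal{U}_1$; and $\mathcal{F}(\mathcal{U}_1\times\mathcal{U}_2)=\{B\subseteq S_1\times S_2\mid\exists A_1\in\mathcal{U}_1,A_2\in\mathcal{U}_2,\ A_1\times A_2\subseteq B\}$. An ultrafilter $\mathcal{U}$ is $\kappa^{+}$-complete if for every family $\{A_i\mid i\in I\}\subseteq\mathcal{U}$ with $|I|<\kappa^{+}$ we have $\bigcap_{i\in I}A_i\in\mathcal{U}$. *)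

theory Defs
  imports Main
begin

unbundle cardinal_syntax

text \<open>Filters and ultrafilters on a carrier set \<open>S\<close> (possibly empty, possibly smaller than its
  type) are families of subsets of \<open>S\<close>. Filters are proper.\<close>

definition filter_on :: "'a set \<Rightarrow> 'a set set \<Rightarrow> bool" where
  "filter_on S F \<longleftrightarrow>
     F \<subseteq> Pow S \<and> S \<in> F \<and> {} \<notin> F \<and>
     (\<forall>A\<in>F. \<forall>B\<in>F. A \<inter> B \<in> F) \<and>
     (\<forall>A\<in>F. \<forall>B. A \<subseteq> B \<and> B \<subseteq> S \<longrightarrow> B \<in> F)"

definition ultrafilter_on :: "'a set \<Rightarrow> 'a set set \<Rightarrow> bool" where
  "ultrafilter_on S U \<longleftrightarrow> filter_on S U \<and> (\<forall>A. A \<subseteq> S \<longrightarrow> A \<in> U \<or> S - A \<in> U)"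

definition beta :: "'a set \<Rightarrow> 'a set set set" where
  "beta S = {U. ultrafilter_on S U}"

definition tensor ::
  "'a set \<Rightarrow> 'b set \<Rightarrow> 'a set set \<Rightarrow> 'b set set \<Rightarrow> ('a \<times> 'b) set set" where
  "tensor S\<^sub>1 S\<^sub>2 U\<^sub>1 U\<^sub>2 =
     {A. A \<subseteq> S\<^sub>1 \<times> S\<^sub>2 \<and> {s\<^sub>1\<in>S\<^sub>1. {s\<^sub>2\<in>S\<^sub>2. (s\<^sub>1, s\<^sub>2) \<in> A} \<in> U\<^sub>2} \<in> U\<^sub>1}"

definition rect_filter ::
  "'a set \<Rightarrow> 'b set \<Rightarrow> 'a set set \<Rightarrow> 'b set set \<Rightarrow> ('a \<times> 'b) set set" where
  "rect_filter S\<^sub>1 S\<^sub>2 U\<^sub>1 U\<^sub>2 =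
     {B. B \<subseteq> S\<^sub>1 \<times> S\<^sub>2 \<and> (\<exists>A\<^sub>1\<in>U\<^sub>1. \<exists>A\<^sub>2\<in>U\<^sub>2. A\<^sub>1 \<times> A\<^sub>2 \<subseteq> B)}"

text \<open>\<open>complete_on S \<mu> U\<close> is \<open>\<mu>\<close>-completeness: closure under intersections of families indexed by
  a set of cardinality less than \<open>\<mu>\<close>. The intersection is taken inside \<open>S\<close>, which matters only for
  the empty family. Index sets are drawn from the type underlying \<open>\<mu>\<close>; by \<open>complete_onD\<close>
  below, this covers index sets of every type.\<close>

definition complete_on :: "'a set \<Rightarrow> 'k rel \<Rightarrow> 'a set set \<Rightarrow> bool" where
  "complete_on S \<mu> U \<longleftrightarrow>
     (\<forall>(I :: 'k set) A. |I| <o \<mu> \<and> (\<forall>i\<in>I. A i \<in> U) \<longrightarrow> S \<inter> (\<Inter>i\<in>I. A i) \<in> U)"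

lemma complete_onD:
  fixes I :: "'i set" and \<mu> :: "'k rel"
  assumes U: "complete_on S \<mu> U" and \<mu>: "Card_order \<mu>"
    and I: "|I| <o \<mu>" and A: "\<And>i. i \<in> I \<Longrightarrow> A i \<in> U"
  shows "S \<inter> (\<Inter>i\<in>I. A i) \<in> U"
proof -
  have "|I| \<le>o |Field \<mu>|"
    by (rule ordLeq_ordIso_trans[OF ordLess_imp_ordLeq[OF I]
          ordIso_symmetric[OF card_of_Field_ordIso[OF \<mu>]]])
  then obtain f :: "'i \<Rightarrow> 'k" where f: "inj_on f I"
    by (auto simp flip: card_of_ordLeq)
  have "|f ` I| <o \<mu>"
    by (rule ordLeq_ordLess_trans[OF card_of_image I])
  moreover have "A (the_inv_into I f k) \<in> U" if "k \<in> f ` I" for k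
    using that A f by (auto simp: the_inv_into_f_f)
  ultimately have "S \<inter> (\<Inter>k\<in>f ` I. A (the_inv_into I f k)) \<in> U"
    using U[unfolded complete_on_def, rule_format, of "f ` I" "\<lambda>k. A (the_inv_into I f k)"]
    by simp
  then show ?thesis
    using f by (simp add: the_inv_into_f_f)
qed

end

theory Submission
  imports Defs
begin

text \<open>Rectangles lie in the tensor product for free. If \<open>U\<^sub>2\<close> is \<open>\<kappa>\<^sup>+\<close>-complete, then a tensor-large
  set \<open>A\<close> contains \<open>X \<times> \<Inter>\<^sub>s\<^sub>\<in>\<^sub>X A\<^sub>s\<close>, where \<open>X\<close> is the set of \<open>s\<close> whose section \<open>A\<^sub>s\<close> is in \<open>U\<^sub>2\<close>.
  Conversely, given \<open>A\<^sub>s \<in> U\<^sub>2\<close> for \<open>s \<in> S\<^sub>1\<close>, the sets \<open>X \<subseteq> S\<^sub>1\<close> with \<open>\<Inter>\<^sub>s\<^sub>\<in>\<^sub>X A\<^sub>s \<in> U\<^sub>2\<close> form an ideal.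
  If it were proper, some ultrafilter \<open>U\<^sub>1\<close> would avoid it; but \<open>{(s, t). t \<in> A\<^sub>s}\<close> is tensor-large,
  and a rectangle inside it has its first side both in \<open>U\<^sub>1\<close> and in the ideal.\<close>

lemma filter_onD:
  assumes "filter_on S F"
  shows "F \<subseteq> Pow S" "S \<in> F" "{} \<notin> F"
    and "\<And>A B. A \<in> F \<Longrightarrow> B \<in> F \<Longrightarrow> A \<inter> B \<in> F"
    and "\<And>A B. A \<in> F \<Longrightarrow> A \<subseteq> B \<Longrightarrow> B \<subseteq> S \<Longrightarrow> B \<in> F"
  using assms unfolding filter_on_def by auto

text \<open>Supplies the upper bounds for Zorn's lemma. Two sets of the union already lie in a
  common filter, the larger of two comparable members of \<open>C\<close>.\<close>

lemma filter_on_Union_chain: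
  assumes "C \<noteq> {}" and C: "\<And>F. F \<in> C \<Longrightarrow> filter_on S F"
    and chain: "\<And>F G. F \<in> C \<Longrightarrow> G \<in> C \<Longrightarrow> F \<subseteq> G \<or> G \<subseteq> F"
  shows "filter_on S (\<Union>C)"
  unfolding filter_on_def
proof (intro conjI ballI allI impI)
  show "\<Union>C \<subseteq> Pow S" using filter_onD(1)[OF C] by blast
  show "S \<in> \<Union>C" using \<open>C \<noteq> {}\<close> filter_onD(2)[OF C] by blast
  show "{} \<notin> \<Union>C" using filter_onD(3)[OF C] by blast
  show "A \<inter> B \<in> \<Union>C" if AB: "A \<in> \<Union>C" "B \<in> \<Union>C" for A B
  proof -
    obtain F G where FG: "F \<in> C" "A \<in> F" "G \<in> C" "B \<in> G" using AB by blast
    then obtain H where "H \<in> C" "A \<in> H" "B \<in> H" using chain[of F G] by blast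
    then show ?thesis using filter_onD(4)[OF C] by blast
  qed
  show "B \<in> \<Union>C" if "A \<in> \<Union>C" "A \<subseteq> B \<and> B \<subseteq> S" for A B
    using that filter_onD(5)[OF C] by blast
qed

text \<open>This is the filter generated by \<open>F\<close> and \<open>A\<close>. It is proper
  because \<open>X \<inter> A = {}\<close> makes \<open>S - A\<close> a superset of
  \<open>X\<close>, forcing \<open>S - A\<close> into \<open>F\<close>.\<close>

lemma filter_on_adjoin:
  assumes F: "filter_on S F" and "S - A \<notin> F"
  shows "filter_on S {B. B \<subseteq> S \<and> (\<exists>X\<in>F. X \<inter> A \<subseteq> B)}"
  unfolding filter_on_def
proof (intro conjI ballI allI impI)
  show "{} \<notin> {B. B \<subseteq> S \<and> (\<exists>X\<in>F. X \<inter> A \<subseteq> B)}"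
  proof
    assume "{} \<in> {B. B \<subseteq> S \<and> (\<exists>X\<in>F. X \<inter> A \<subseteq> B)}"
    then obtain X where X: "X \<in> F" "X \<inter> A \<subseteq> {}" by auto
    then have "S - A \<in> F" using filter_onD(1)[OF F] by (intro filter_onD(5)[OF F X(1)]) auto
    then show False using assms(2) by blast
  qed
  show "B \<inter> B' \<in> {B. B \<subseteq> S \<and> (\<exists>X\<in>F. X \<inter> A \<subseteq> B)}"
    if BB': "B \<in> {B. B \<subseteq> S \<and> (\<exists>X\<in>F. X \<inter> A \<subseteq> B)}" "B' \<in> {B. B \<subseteq> S \<and> (\<exists>X\<in>F. X \<inter> A \<subseteq> B)}" for B B'
  proof -
    obtain X X' where "X \<in> F" "X \<inter> A \<subseteq> B" "X' \<in> F" "X' \<inter> A \<subseteq> B'" using BB' by blast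
    then have "X \<inter> X' \<in> F" "(X \<inter> X') \<inter> A \<subseteq> B \<inter> B'" using filter_onD(4)[OF F] by auto
    then show ?thesis using BB' by blast
  qed
  show "S \<in> {B. B \<subseteq> S \<and> (\<exists>X\<in>F. X \<inter> A \<subseteq> B)}" using filter_onD(2)[OF F] by auto
qed auto

text \<open>Zorn's lemma gives a maximal filter above \<open>F\<close>. Maximality decides every
  \<open>A\<close>: unless \<open>S - A\<close> is present, adjoining \<open>A\<close> gives a
  filter, which cannot be strictly larger.\<close>

lemma ultrafilter_on_extension:
  assumes F: "filter_on S F"
  obtains U where "ultrafilter_on S U" "F \<subseteq> U"
proof -
  have "\<exists>U\<in>{G. filter_on S G \<and> F \<subseteq> G}. \<forall>G\<in>{G. filter_on S G \<and> F \<subseteq> G}. U \<subseteq> G \<longrightarrow> G = U"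
  proof (rule subset_Zorn_nonempty)
    show "{G. filter_on S G \<and> F \<subseteq> G} \<noteq> {}" using F by blast
    show "\<Union>C \<in> {G. filter_on S G \<and> F \<subseteq> G}"
      if "C \<noteq> {}" "subset.chain {G. filter_on S G \<and> F \<subseteq> G} C" for C
    proof -
      have C: "\<And>G. G \<in> C \<Longrightarrow> filter_on S G" "\<And>G. G \<in> C \<Longrightarrow> F \<subseteq> G"
        "\<And>G H. G \<in> C \<Longrightarrow> H \<in> C \<Longrightarrow> G \<subseteq> H \<or> H \<subseteq> G"
        using that(2) by (auto simp: subset_chain_def)
      have "filter_on S (\<Union>C)" by (rule filter_on_Union_chain[OF that(1) C(1) C(3)])
      moreover have "F \<subseteq> \<Union>C" using that(1) C(2) by blast
      ultimately show ?thesis by simp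
    qed
  qed
  then obtain U where U: "filter_on S U" "F \<subseteq> U"
    and max: "\<And>G. filter_on S G \<Longrightarrow> U \<subseteq> G \<Longrightarrow> G = U"
    by auto
  have "A \<in> U" if "A \<subseteq> S" "S - A \<notin> U" for A
  proof -
    let ?G = "{B. B \<subseteq> S \<and> (\<exists>X\<in>U. X \<inter> A \<subseteq> B)}"
    have "U \<subseteq> ?G" using filter_onD(1)[OF U(1)] by blast
    then have "?G = U" by (rule max[OF filter_on_adjoin[OF U(1) that(2)]])
    moreover have "A \<in> ?G" using that(1) filter_onD(2)[OF U(1)] by blast
    ultimately show ?thesis by simp
  qed
  then have "ultrafilter_on S U" using U(1) unfolding ultrafilter_on_def by blast
  then show thesis using U(2) by (rule that)
qed

text \<open>Over each point of \<open>A\<^sub>1\<close> the section of \<open>B\<close> contains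
  \<open>A\<^sub>2\<close>.\<close>

lemma rect_filter_subset_tensor:
  assumes "filter_on S\<^sub>1 U\<^sub>1" and "filter_on S\<^sub>2 U\<^sub>2"
  shows "rect_filter S\<^sub>1 S\<^sub>2 U\<^sub>1 U\<^sub>2 \<subseteq> tensor S\<^sub>1 S\<^sub>2 U\<^sub>1 U\<^sub>2"
proof
  fix B assume "B \<in> rect_filter S\<^sub>1 S\<^sub>2 U\<^sub>1 U\<^sub>2"
  then obtain A\<^sub>1 A\<^sub>2 where B: "B \<subseteq> S\<^sub>1 \<times> S\<^sub>2" "A\<^sub>1 \<in> U\<^sub>1" "A\<^sub>2 \<in> U\<^sub>2" "A\<^sub>1 \<times> A\<^sub>2 \<subseteq> B"
    by (auto simp: rect_filter_def)
  have sub: "A\<^sub>1 \<subseteq> S\<^sub>1" "A\<^sub>2 \<subseteq> S\<^sub>2" using B filter_onD(1)[OF assms(1)] filter_onD(1)[OF assms(2)] by auto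
  have "{t\<in>S\<^sub>2. (s, t) \<in> B} \<in> U\<^sub>2" if "s \<in> A\<^sub>1" for s
    using that B sub by (intro filter_onD(5)[OF assms(2) B(3)]) auto
  then have "{s\<in>S\<^sub>1. {t\<in>S\<^sub>2. (s, t) \<in> B} \<in> U\<^sub>2} \<in> U\<^sub>1"
    using sub by (intro filter_onD(5)[OF assms(1) B(2)]) auto
  then show "B \<in> tensor S\<^sub>1 S\<^sub>2 U\<^sub>1 U\<^sub>2" using B by (simp add: tensor_def)
qed

lemma tensor_subset_rect_filter:
  assumes U1: "filter_on S\<^sub>1 U\<^sub>1" and U2: "complete_on S\<^sub>2 (cardSuc |S\<^sub>1| ) U\<^sub>2"
  shows "tensor S\<^sub>1 S\<^sub>2 U\<^sub>1 U\<^sub>2 \<subseteq> rect_filter S\<^sub>1 S\<^sub>2 U\<^sub>1 U\<^sub>2"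
proof
  fix A assume A: "A \<in> tensor S\<^sub>1 S\<^sub>2 U\<^sub>1 U\<^sub>2"
  define X where "X = {s\<in>S\<^sub>1. {t\<in>S\<^sub>2. (s, t) \<in> A} \<in> U\<^sub>2}"
  have X: "X \<in> U\<^sub>1" "A \<subseteq> S\<^sub>1 \<times> S\<^sub>2" using A by (auto simp: tensor_def X_def)
  have "|X| \<le>o |S\<^sub>1|" by (rule card_of_mono1) (auto simp: X_def)
  then have "|X| <o cardSuc |S\<^sub>1|" by (simp only: cardSuc_ordLeq_ordLess card_of_Card_order)
  \<comment> \<open>\<open>X\<close> lives in \<open>'a\<close>, while the index sets in the
    definition live in \<open>'a set\<close>, the type underlying
    \<open>cardSuc |S\<^sub>1|\<close>; \<open>complete_onD\<close> bridges the two.\<close>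
  then have "S\<^sub>2 \<inter> (\<Inter>s\<in>X. {t\<in>S\<^sub>2. (s, t) \<in> A}) \<in> U\<^sub>2"
    by (intro complete_onD[OF U2] cardSuc_Card_order card_of_Card_order) (auto simp: X_def)
  moreover have "X \<times> (S\<^sub>2 \<inter> (\<Inter>s\<in>X. {t\<in>S\<^sub>2. (s, t) \<in> A})) \<subseteq> A" by auto
  ultimately show "A \<in> rect_filter S\<^sub>1 S\<^sub>2 U\<^sub>1 U\<^sub>2" using X by (auto simp: rect_filter_def)
qed

lemma Inter_mem_if_tensor_subset_rect_filter:
  assumes U2: "filter_on S\<^sub>2 U\<^sub>2" and A: "\<And>s. s \<in> S\<^sub>1 \<Longrightarrow> A s \<in> U\<^sub>2"
    and rect: "\<And>U\<^sub>1. U\<^sub>1 \<in> beta S\<^sub>1 \<Longrightarrow> tensor S\<^sub>1 S\<^sub>2 U\<^sub>1 U\<^sub>2 \<subseteq> rect_filter S\<^sub>1 S\<^sub>2 U\<^sub>1 U\<^sub>2"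
  shows "S\<^sub>2 \<inter> (\<Inter>s\<in>S\<^sub>1. A s) \<in> U\<^sub>2"
proof (rule ccontr)
  assume notin: "S\<^sub>2 \<inter> (\<Inter>s\<in>S\<^sub>1. A s) \<notin> U\<^sub>2"
  \<comment> \<open>The filter dual to the ideal: complements of the index sets whose intersection
    is large. It is proper exactly by \<open>notin\<close>, and contains \<open>S\<^sub>1\<close>
    because the empty intersection is cut down to \<open>S\<^sub>2\<close>.\<close>
  define F where "F = {Y. Y \<subseteq> S\<^sub>1 \<and> S\<^sub>2 \<inter> (\<Inter>s\<in>S\<^sub>1 - Y. A s) \<in> U\<^sub>2}"
  have "filter_on S\<^sub>1 F"
    unfolding filter_on_def
  proof (intro conjI ballI allI impI)
    show "F \<subseteq> Pow S\<^sub>1" "S\<^sub>1 \<in> F" "{} \<notin> F" using filter_onD(2)[OF U2] notin by (auto simp: F_def)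
    show "Y \<inter> Z \<in> F" if "Y \<in> F" "Z \<in> F" for Y Z
    proof -
      have "S\<^sub>2 \<inter> (\<Inter>s\<in>S\<^sub>1 - (Y \<inter> Z). A s)
          = (S\<^sub>2 \<inter> (\<Inter>s\<in>S\<^sub>1 - Y. A s)) \<inter> (S\<^sub>2 \<inter> (\<Inter>s\<in>S\<^sub>1 - Z. A s))" by blast
      then show ?thesis using that filter_onD(4)[OF U2] by (auto simp: F_def)
    qed
    show "Z \<in> F" if "Y \<in> F" "Y \<subseteq> Z \<and> Z \<subseteq> S\<^sub>1" for Y Z
    proof -
      have "S\<^sub>2 \<inter> (\<Inter>s\<in>S\<^sub>1 - Y. A s) \<in> U\<^sub>2" using that by (simp add: F_def)
      then have "S\<^sub>2 \<inter> (\<Inter>s\<in>S\<^sub>1 - Z. A s) \<in> U\<^sub>2"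
        by (rule filter_onD(5)[OF U2]) (use that in auto)
      then show ?thesis using that by (simp add: F_def)
    qed
  qed
  then obtain U\<^sub>1 where U1: "ultrafilter_on S\<^sub>1 U\<^sub>1" "F \<subseteq> U\<^sub>1" by (rule ultrafilter_on_extension)
  then have fil: "filter_on S\<^sub>1 U\<^sub>1" by (simp add: ultrafilter_on_def)
  define B where "B = {(s, t). s \<in> S\<^sub>1 \<and> t \<in> S\<^sub>2 \<and> t \<in> A s}"
  have "{t\<in>S\<^sub>2. (s, t) \<in> B} = A s" if "s \<in> S\<^sub>1" for s
    using that A filter_onD(1)[OF U2] by (auto simp: B_def)
  then have "{s\<in>S\<^sub>1. {t\<in>S\<^sub>2. (s, t) \<in> B} \<in> U\<^sub>2} = S\<^sub>1" using A by auto
  then have "B \<in> tensor S\<^sub>1 S\<^sub>2 U\<^sub>1 U\<^sub>2"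
    using filter_onD(2)[OF fil] by (auto simp: tensor_def B_def)
  then have "B \<in> rect_filter S\<^sub>1 S\<^sub>2 U\<^sub>1 U\<^sub>2" using rect U1 by (auto simp: beta_def)
  then obtain X Y where XY: "X \<in> U\<^sub>1" "Y \<in> U\<^sub>2" "X \<times> Y \<subseteq> B" by (auto simp: rect_filter_def)
  have X: "X \<subseteq> S\<^sub>1" and Y: "Y \<subseteq> S\<^sub>2" using XY filter_onD(1)[OF fil] filter_onD(1)[OF U2] by auto
  \<comment> \<open>\<open>X \<times> Y \<subseteq> B\<close> says that \<open>Y\<close> lies in
    every \<open>A s\<close> with \<open>s\<close> in \<open>X\<close>. So \<open>X\<close> is in
    the ideal, and \<open>U\<^sub>1\<close> contains both \<open>X\<close> and its
    complement.\<close>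
  have "S\<^sub>2 \<inter> (\<Inter>s\<in>X. A s) \<in> U\<^sub>2"
    using XY Y by (intro filter_onD(5)[OF U2 XY(2)]) (auto simp: B_def)
  moreover have "S\<^sub>1 - (S\<^sub>1 - X) = X" using X by blast
  ultimately have "S\<^sub>1 - X \<in> F" by (simp add: F_def)
  then have "X \<inter> (S\<^sub>1 - X) \<in> U\<^sub>1" using XY(1) U1(2) filter_onD(4)[OF fil] by blast
  then show False using filter_onD(3)[OF fil] by simp
qed

text \<open>Families indexed by \<open>S\<^sub>1\<close> itself suffice: a set of cardinality below
  the successor injects into \<open>S\<^sub>1\<close>, so any smaller family can be transported
  there and padded.\<close>

lemma complete_on_cardSucI:
  fixes S\<^sub>1 :: "'a set"
  assumes S2: "S\<^sub>2 \<in> U\<^sub>2"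
    and Inter: "\<And>A. (\<And>s. s \<in> S\<^sub>1 \<Longrightarrow> A s \<in> U\<^sub>2) \<Longrightarrow> S\<^sub>2 \<inter> (\<Inter>s\<in>S\<^sub>1. A s) \<in> U\<^sub>2"
  shows "complete_on S\<^sub>2 (cardSuc |S\<^sub>1| ) U\<^sub>2"
  unfolding complete_on_def
proof (intro allI impI, elim conjE)
  fix I :: "'a set set" and A
  assume I: "|I| <o cardSuc |S\<^sub>1|" and A: "\<forall>i\<in>I. A i \<in> U\<^sub>2"
  have "|I| \<le>o |S\<^sub>1|" using I by (simp only: cardSuc_ordLeq_ordLess card_of_Card_order)
  then obtain f where f: "inj_on f I" "f ` I \<subseteq> S\<^sub>1" by (auto simp flip: card_of_ordLeq)
  \<comment> \<open>The default \<open>S\<^sub>2\<close> pads the family outside the image of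
    \<open>f\<close>. It is a member of \<open>U\<^sub>2\<close> and neutral for intersections taken
    inside \<open>S\<^sub>2\<close>.\<close>
  define A' where "A' s = (if s \<in> f ` I then A (the_inv_into I f s) else S\<^sub>2)" for s
  have A'_f: "A' (f i) = A i" if "i \<in> I" for i using that f(1) by (simp add: A'_def the_inv_into_f_f)
  have "A' s \<in> U\<^sub>2" for s
  proof (cases "s \<in> f ` I")
    case True
    then show ?thesis using A A'_f by auto
  qed (simp add: A'_def S2)
  then have "S\<^sub>2 \<inter> (\<Inter>s\<in>S\<^sub>1. A' s) \<in> U\<^sub>2" by (rule Inter)
  also have "S\<^sub>2 \<inter> (\<Inter>s\<in>S\<^sub>1. A' s) = S\<^sub>2 \<inter> (\<Inter>s\<in>f ` I. A' s)"
    using f(2) by (auto simp: A'_def)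
  also have "\<dots> = S\<^sub>2 \<inter> (\<Inter>i\<in>I. A i)" using A'_f by auto
  finally show "S\<^sub>2 \<inter> (\<Inter>i\<in>I. A i) \<in> U\<^sub>2" .
qed

theorem theorem4p11:
  fixes S\<^sub>1 :: "'a set" and S\<^sub>2 :: "'b set" and U\<^sub>2 :: "'b set set"
  assumes "U\<^sub>2 \<in> beta S\<^sub>2"
  shows "(\<forall>U\<^sub>1\<in>beta S\<^sub>1. tensor S\<^sub>1 S\<^sub>2 U\<^sub>1 U\<^sub>2 = rect_filter S\<^sub>1 S\<^sub>2 U\<^sub>1 U\<^sub>2) \<longleftrightarrow>
         complete_on S\<^sub>2 (cardSuc |S\<^sub>1| ) U\<^sub>2"
proof
  have U2: "filter_on S\<^sub>2 U\<^sub>2" using assms by (simp add: beta_def ultrafilter_on_def)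
  {
    assume "\<forall>U\<^sub>1\<in>beta S\<^sub>1. tensor S\<^sub>1 S\<^sub>2 U\<^sub>1 U\<^sub>2 = rect_filter S\<^sub>1 S\<^sub>2 U\<^sub>1 U\<^sub>2"
    then show "complete_on S\<^sub>2 (cardSuc |S\<^sub>1| ) U\<^sub>2"
      by (intro complete_on_cardSucI filter_onD(2)[OF U2]
            Inter_mem_if_tensor_subset_rect_filter[OF U2]) auto
  next
    assume "complete_on S\<^sub>2 (cardSuc |S\<^sub>1| ) U\<^sub>2"
    then show "\<forall>U\<^sub>1\<in>beta S\<^sub>1. tensor S\<^sub>1 S\<^sub>2 U\<^sub>1 U\<^sub>2 = rect_filter S\<^sub>1 S\<^sub>2 U\<^sub>1 U\<^sub>2"
      by (intro ballI equalityI tensor_subset_rect_filter rect_filter_subset_tensor U2)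
        (simp_all add: beta_def ultrafilter_on_def)
  }
qed

end
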